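(* Let $G$ be a simple graph with $m$ edges and maximum degree $\Delta$. Then $$DSO(G)\geq \frac{1}{2\Delta}\sqrt{F(G)+m(m-1)\big(\Pi_{F}(G)\big)^{1/m}}.$$
   Context: For a simple graph $G=(V,E)$, $d_u$ denotes the degree of vertex $u$. The Diminished Sombor index is $DSO(G)=\sum_{uv\in E}\frac{\sqrt{d_u^2+d_v^2}}{d_u+d_v}$. The forgotten index is $F(G)=\sum_{uv\in E}(d_u^2+d_v^2)$ and the multiplicative forgotten index is $\Pi_F(G)=\prod_{uv\in E}(d_u^2+d_v^2)$. *)

theory Defs
  imports Complex_Main
begin

locale simple_graph =
  fixes V :: "'a set" and E :: "'a set set"
  assumes finite_vertices: "finite V"
    and edges: "\<And>e. e \<in> E \<Longrightarrow> e \<subseteq> V \<and> card e = 2"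

definition degree :: "'a set set \<Rightarrow> 'a \<Rightarrow> nat" where
  "degree E v = card {e \<in> E. v \<in> e}"

definition max_degree :: "'a set \<Rightarrow> 'a set set \<Rightarrow> nat" where
  "max_degree V E = Max (degree E ` V)"

(* An edge uv is the two-element set e = {u, v}, so a sum over w in e of f w
   is f u + f v; this avoids choosing an orientation of the edge. *)

definition diminished_sombor :: "'a set set \<Rightarrow> real" where
  "diminished_sombor E =
     (\<Sum>e\<in>E. sqrt (\<Sum>w\<in>e. (real (degree E w))\<^sup>2) / (\<Sum>w\<in>e. real (degree E w)))"

definition forgotten :: "'a set set \<Rightarrow> real" where
  "forgotten E = (\<Sum>e\<in>E. \<Sum>w\<in>e. (real (degree E w))\<^sup>2)"

definition mult_forgotten :: "'a set set \<Rightarrow> real" where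
  "mult_forgotten E = (\<Prod>e\<in>E. \<Sum>w\<in>e. (real (degree E w))\<^sup>2)"

end

theory Submission
  imports Defs "HOL-Analysis.Convex"
begin

text \<open>
  Write \<open>s\<^sub>e = sqrt (d\<^sub>u\<^sup>2 + d\<^sub>v\<^sup>2)\<close> for an edge \<open>e = uv\<close>. Every degree sum
  \<open>d\<^sub>u + d\<^sub>v\<close> is at most \<open>2\<Delta>\<close>, so the index is at least \<open>(\<Sum>\<^sub>e s\<^sub>e) / (2\<Delta>)\<close>. In the
  square of \<open>\<Sum>\<^sub>e s\<^sub>e\<close> the diagonal terms add up to the forgotten index, and the arithmetic-geometric
  mean inequality bounds the sum of the \<open>m(m - 1)\<close> off-diagonal terms \<open>s\<^sub>e s\<^sub>f\<close>, in whose product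
  each \<open>s\<^sub>e\<close> occurs \<open>2(m - 1)\<close> times.
\<close>

text \<open>With \<open>n = card I\<close> and \<open>P\<close> the full product, row
  \<open>i\<close> contributes \<open>x i ^ (n - 1) * (P / x i)\<close>. Multiplying the rows gives
  \<open>P ^ (n - 1) * (P ^ n / P)\<close>. Nonzero factors make the division legitimate.\<close>

lemma prod_off_diagonal:
  fixes x :: "'b \<Rightarrow> 'c::field"
  assumes "finite I" and nz: "\<And>i. i \<in> I \<Longrightarrow> x i \<noteq> 0"
  shows "(\<Prod>i\<in>I. \<Prod>j\<in>I - {i}. x i * x j) = (\<Prod>i\<in>I. x i) ^ (2 * (card I - 1))"
proof (cases "I = {}")
  case False
  with assms have card: "card I = Suc (card I - 1)"
    by (simp add: card_gt_0_iff)
  define P where "P = (\<Prod>i\<in>I. x i)"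
  have "P \<noteq> 0"
    using assms by (simp add: P_def)
  have "(\<Prod>i\<in>I. \<Prod>j\<in>I - {i}. x i * x j) = (\<Prod>i\<in>I. x i ^ (card I - 1) * (P / x i))"
    using assms by (intro prod.cong) (simp_all add: prod.distrib prod_diff1 P_def)
  also have "\<dots> = P ^ (card I - 1) * (P ^ card I / P)"
    by (simp add: prod.distrib prod_dividef prod_power_distrib P_def)
  \<comment> \<open>Cancelling one factor \<open>P\<close> uses \<open>card I > 0\<close>, so that
    the truncated \<open>card I - 1\<close> is the true predecessor.\<close>
  also have "P ^ card I / P = P ^ (card I - 1)"
    using \<open>P \<noteq> 0\<close> by (subst card) simp
  finally show ?thesis
    by (simp add: P_def mult_2 power_add)
qed simp

lemma sum_squared_ge_sum_squares_plus_geometric_mean: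
  fixes x :: "'b \<Rightarrow> real"
  assumes fin: "finite I" and pos: "\<And>i. i \<in> I \<Longrightarrow> x i > 0"
  shows "(\<Sum>i\<in>I. (x i)\<^sup>2) + real (card I) * (real (card I) - 1) *
           (\<Prod>i\<in>I. (x i)\<^sup>2) powr (1 / real (card I)) \<le> (\<Sum>i\<in>I. x i)\<^sup>2"
proof -
  define m where "m = card I"
  define P where "P = (\<Prod>i\<in>I. x i)"
  \<comment> \<open>The ordered off-diagonal pairs as one index set: AM-GM is applied once, to a
    single sum over \<open>S\<close>.\<close>
  define S where "S = (SIGMA i:I. I - {i})"
  have "P > 0"
    using pos by (simp add: P_def prod_pos)
  have split: "(\<Sum>i\<in>I. x i)\<^sup>2 = (\<Sum>i\<in>I. (x i)\<^sup>2) + (\<Sum>i\<in>I. \<Sum>j\<in>I - {i}. x i * x j)"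
  proof -
    have "(\<Sum>i\<in>I. x i)\<^sup>2 = (\<Sum>i\<in>I. \<Sum>j\<in>I. x i * x j)"
      by (simp add: power2_eq_square sum_product)
    also have "\<dots> = (\<Sum>i\<in>I. (x i)\<^sup>2 + (\<Sum>j\<in>I - {i}. x i * x j))"
      by (intro sum.cong) (simp_all add: power2_eq_square sum.remove[OF fin])
    finally show ?thesis
      by (simp add: sum.distrib)
  qed
  have "real m * (real m - 1) * (\<Prod>i\<in>I. (x i)\<^sup>2) powr (1 / real m)
          \<le> (\<Sum>i\<in>I. \<Sum>j\<in>I - {i}. x i * x j)"
  proof (cases "m \<le> 1")
    \<comment> \<open>There are no off-diagonal pairs to average, but the factor
      \<open>m * (m - 1)\<close> makes the left side zero.\<close>
    case True
    then have "m = 0 \<or> m = 1"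
      by auto
    moreover have "0 \<le> (\<Sum>i\<in>I. \<Sum>j\<in>I - {i}. x i * x j)"
      using pos by (intro sum_nonneg) (simp add: less_imp_le)
    ultimately show ?thesis
      by auto
  next
    case False
    have finS: "finite S"
      using fin by (simp add: S_def)
    have cardS: "real (card S) = real m * (real m - 1)"
      using fin False by (simp add: S_def m_def card_SigmaI of_nat_diff)
    have cardS_pos: "real (card S) > 0"
      using False by (simp add: cardS)
    have "S \<noteq> {}"
      using cardS_pos by auto
    have "(\<Prod>(i,j)\<in>S. x i * x j) = P ^ (2 * (m - 1))"
      using prod_off_diagonal[of I x] fin pos
      by (simp add: S_def P_def m_def less_imp_neq[symmetric] flip: prod.Sigma)
    then have "(\<Prod>(i,j)\<in>S. x i * x j) powr (1 / real (card S))
                 = P powr (real (2 * (m - 1)) / real (card S))"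
      using \<open>P > 0\<close> by (simp add: powr_powr flip: powr_realpow)
    \<comment> \<open>Since \<open>S\<close> has \<open>m * (m - 1)\<close> elements, the factor
      \<open>m - 1\<close> cancels; it is nonzero because \<open>m > 1\<close>.\<close>
    also have "real (2 * (m - 1)) / real (card S) = 2 / real m"
      using False by (simp add: cardS of_nat_diff divide_simps)
    also have "P powr (2 / real m) = (P\<^sup>2) powr (1 / real m)"
      using \<open>P > 0\<close> by (simp add: powr_powr flip: powr_numeral)
    also have "P\<^sup>2 = (\<Prod>i\<in>I. (x i)\<^sup>2)"
      by (simp add: P_def prod_power_distrib)
    finally have gm: "(\<Prod>(i,j)\<in>S. x i * x j) powr (1 / real (card S))
                        = (\<Prod>i\<in>I. (x i)\<^sup>2) powr (1 / real m)" .
    \<comment> \<open>AM-GM over \<open>S\<close>; by \<open>gm\<close> its left side is the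
      geometric mean of the squares.\<close>
    have "(\<Prod>(i,j)\<in>S. x i * x j) powr (1 / real (card S))
            \<le> (\<Sum>p\<in>S. (case p of (i,j) \<Rightarrow> x i * x j) / real (card S))"
      using finS \<open>S \<noteq> {}\<close> pos
      by (intro arith_geom_mean) (auto simp: S_def less_imp_le)
    then have "real (card S) * (\<Prod>i\<in>I. (x i)\<^sup>2) powr (1 / real m) \<le> (\<Sum>(i,j)\<in>S. x i * x j)"
      using cardS_pos by (simp add: gm field_simps flip: sum_divide_distrib)
    then show ?thesis
      unfolding cardS using fin by (simp add: S_def sum.Sigma)
  qed
  then show ?thesis
    by (simp add: split m_def)
qed

context simple_graph
begin

lemma finite_edges: "finite E"
proof (rule finite_subset)
  show "E \<subseteq> Pow V"
    using edges by auto
qed (simp add: finite_vertices)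

lemma degree_pos: "e \<in> E \<Longrightarrow> v \<in> e \<Longrightarrow> degree E v > 0"
  using finite_edges by (auto simp: degree_def card_gt_0_iff)

lemma degree_le_max_degree: "v \<in> V \<Longrightarrow> degree E v \<le> max_degree V E"
  using finite_vertices by (simp add: max_degree_def)

lemma edge_finite_nonempty:
  assumes "e \<in> E"
  shows "finite e" "e \<noteq> {}"
  using edges[OF assms] by (auto intro: card_ge_0_finite)

lemma sum_edge_degrees_pos: "e \<in> E \<Longrightarrow> (\<Sum>w\<in>e. real (degree E w)) > 0"
  using edge_finite_nonempty by (intro sum_pos) (auto intro: degree_pos)

lemma sum_edge_degrees_squared_pos: "e \<in> E \<Longrightarrow> (\<Sum>w\<in>e. (real (degree E w))\<^sup>2) > 0"
  using edge_finite_nonempty by (intro sum_pos) (auto dest: degree_pos)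

lemma sum_edge_degrees_le:
  assumes "e \<in> E"
  shows "(\<Sum>w\<in>e. real (degree E w)) \<le> 2 * real (max_degree V E)"
proof -
  have "(\<Sum>w\<in>e. real (degree E w)) \<le> real (card e) * real (max_degree V E)"
    using edges[OF assms] by (intro sum_bounded_above) (auto intro: degree_le_max_degree)
  then show ?thesis
    using edges[OF assms] by simp
qed

text \<open>Termwise: enlarging the positive denominator \<open>d_u + d_v\<close> to
  \<open>2 * \<Delta>\<close> shrinks the fraction. An edge forces \<Delta> > 0, and without edges
  both sums are empty.\<close>

lemma diminished_sombor_ge:
  "(\<Sum>e\<in>E. sqrt (\<Sum>w\<in>e. (real (degree E w))\<^sup>2)) / (2 * real (max_degree V E))
     \<le> diminished_sombor E"
  unfolding diminished_sombor_def sum_divide_distrib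
proof (rule sum_mono)
  fix e assume "e \<in> E"
  then show "sqrt (\<Sum>w\<in>e. (real (degree E w))\<^sup>2) / (2 * real (max_degree V E))
      \<le> sqrt (\<Sum>w\<in>e. (real (degree E w))\<^sup>2) / (\<Sum>w\<in>e. real (degree E w))"
    by (intro frac_le sum_edge_degrees_le sum_edge_degrees_pos) (simp_all add: sum_nonneg)
qed

end

theorem theorem3p12:
  fixes V :: "'a set" and E :: "'a set set" and m \<Delta> :: nat
  assumes "simple_graph V E"
    and "card E = m"
    and "max_degree V E = \<Delta>"
  shows "diminished_sombor E \<ge>
    1 / (2 * real \<Delta>) *
      sqrt (forgotten E + real m * (real m - 1) * mult_forgotten E powr (1 / real m))"
proof -
  interpret simple_graph V E
    by (fact assms(1))
  define s where "s e = sqrt (\<Sum>w\<in>e. (real (degree E w))\<^sup>2)" for e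
  have s_pos: "s e > 0" if "e \<in> E" for e
    using sum_edge_degrees_squared_pos[OF that] by (simp add: s_def)
  have s_sq: "(s e)\<^sup>2 = (\<Sum>w\<in>e. (real (degree E w))\<^sup>2)" for e
    by (simp add: s_def sum_nonneg)
  have "forgotten E + real m * (real m - 1) * mult_forgotten E powr (1 / real m)
          \<le> (\<Sum>e\<in>E. s e)\<^sup>2"
    \<comment> \<open>Taking \<open>x = s\<close> turns the sum and the product of the squares into
      the two forgotten indices.\<close>
    using sum_squared_ge_sum_squares_plus_geometric_mean[OF finite_edges, of s] s_pos assms(2)
    by (simp add: s_sq forgotten_def mult_forgotten_def)
  then have "sqrt (forgotten E + real m * (real m - 1) * mult_forgotten E powr (1 / real m))
          \<le> (\<Sum>e\<in>E. s e)"
    by (intro real_le_lsqrt sum_nonneg) (simp_all add: s_pos less_imp_le)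
  then have "1 / (2 * real \<Delta>) *
      sqrt (forgotten E + real m * (real m - 1) * mult_forgotten E powr (1 / real m))
      \<le> (\<Sum>e\<in>E. s e) / (2 * real \<Delta>)"
    \<comment> \<open>This covers \<Delta> = 0 as well: division by zero yields 0, so both sides
      vanish.\<close>
    by (simp add: divide_right_mono)
  also have "\<dots> \<le> diminished_sombor E"
    using diminished_sombor_ge assms(3) by (simp add: s_def)
  finally show ?thesis .
qed

end
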